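(* Consider the full-order solution and the WST-LSPG solution over windows $k\in\{0,\dots,N_w-1\}$, as defined in the context. Assume: (A1) there is $\kappa>0$ with $\|\boldsymbol f(\boldsymbol w,t)-\boldsymbol f(\boldsymbol y,t)\|_2\le\kappa\|\boldsymbol w-\boldsymbol y\|_2$ for all $\boldsymbol w,\boldsymbol y\in\mathbb R^{N_s}$, $t\in[0,T]$; (A2) $\sigma_{\min}(\boldsymbol A^k)-\sigma_{\max}(\boldsymbol B^k)\,\Delta t\,\kappa>0$. Then the error between the WST-LSPG solution and the full-order solution over the $k$-th window satisfies $$\|\boldsymbol e^k\|_2\le\frac1{a^k}\big\|\overline{\boldsymbol r}^k(\tilde{\boldsymbol u}^k;\tilde{\boldsymbol u}_0^k)\big\|_2+\frac{b^k}{a^k}\|\boldsymbol e_0^k\|_2,$$ where $\boldsymbol e^k=\tilde{\boldsymbol u}^k-\boldsymbol u^k$, $\boldsymbol e_0^k=\tilde{\boldsymbol u}_0^k-\boldsymbol u_0^k$, $a^k=\sigma_{\min}(\boldsymbol A^k)-\sigma_{\max}(\boldsymbol B^k)\Delta t\,\kappa$ and $b^k=\sigma_{\max}(\boldsymbol A_0^k)+\Delta t\,\kappa\,\sigma_{\max}(\boldsymbol B_0^k)$.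
   Context: All superscripts $k$ are window indices, not powers. $\sigma_{\min},\sigma_{\max}$ denote minimum and maximum singular values; $\|\cdot\|_2$ is the Euclidean norm. A parameter value is fixed and suppressed. Full-order model: an ODE $\dot{\boldsymbol u}=\boldsymbol f(\boldsymbol u,t)$ with $\boldsymbol f:\mathbb R^{N_s}\times[0,T]\to\mathbb R^{N_s}$ and initial state $\boldsymbol u^{\mathrm{init}}\in\mathbb R^{N_s}$ is discretized at times $t^0<t^1<\dots<t^{N_t}$ with constant step $\Delta t>0$ by a linear multistep method with stencil width $s_n$ at step $n$: coefficients $\alpha_j^n,\beta_j^n\in\mathbb R$, $0\le j\le s_n$, with $\alpha_0^n\ne0$ and $\sum_{j=0}^{s_n}\alpha_j^n=0$, and residual $$\boldsymbol r^n(\boldsymbol w^n;\boldsymbol w^{n-1},\dots,\boldsymbol w^{n-s_n})=\sum_{j=0}^{s_n}\alpha_j^n\boldsymbol w^{n-j}-\Delta t\sum_{j=0}^{s_n}\beta_j^n\boldsymbol f(\boldsymbol w^{n-j},t^{n-j}).$$ Windows: the steps $1,\dots,N_t$ are partitioned into $N_w$ consecutive windows; window $k\in\{0,\dots,N_w-1\}$ contains $N_t^k$ steps, namely $\theta(k),\dots,\theta(k)+N_t^k-1$, with $\theta(k)=1+\sum_{j=0}^{k-1}N_t^j$. The stencil width at the first step of each window is one ($s_{\theta(k)}=1$), and no stencil inside a window reaches back before the state at step $\theta(k)-1$ (i.e. $s_{\theta(k)+\ell-1}\le\ell$ for $1\le\ell\le N_t^k$). Windowed residual: for $\boldsymbol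 w=[(\boldsymbol w^1)^T\cdots(\boldsymbol w^{N_t^k})^T]^T\in\mathbb R^{N_sN_t^k}$ and starting state $\boldsymbol w_0\in\mathbb R^{N_s}$, $\overline{\boldsymbol r}^k(\boldsymbol w;\boldsymbol w_0)\in\mathbb R^{N_sN_t^k}$ stacks the residuals of all steps of window $k$ (with $\boldsymbol w^\ell$ the state at step $\theta(k)+\ell-1$ and $\boldsymbol w_0$ the state at step $\theta(k)-1$). Equivalently $$\overline{\boldsymbol r}^k(\boldsymbol w;\boldsymbol w_0)=\boldsymbol A^k\boldsymbol w-\Delta t\,\boldsymbol B^k\,\overline{\boldsymbol f}^k(\boldsymbol w)+\boldsymbol A_0^k\boldsymbol w_0-\Delta t\,\boldsymbol B_0^k\boldsymbol f(\boldsymbol w_0,t^{\theta(k)-1}),$$ where $\overline{\boldsymbol f}^k(\boldsymbol w)$ stacks $\boldsymbol f(\boldsymbol w^\ell,t^{\theta(k)+\ell-1})$, $\ell=1,\dots,N_t^k$; $\boldsymbol A^k\in\mathbb R^{N_sN_t^k\times N_sN_t^k}$ has $N_s\times N_s$ block $(\ell,\ell-j)$ equal to $\alpha_j^{\theta(k)+\ell-1}\boldsymbol I$ for $0\le j\le s_{\theta(k)+\ell-1}$, $\ell-j\ge1$, other blocks zero; $\boldsymbol A_0^k\in\mathbb R^{N_sN_t^k\times N_s}$ has $\ell$-th block $\alpha_\ell^{\theta(k)+\ell-1}\boldsymbol I$ if $s_{\theta(k)+\ell-1}=\ell$ and zero otherwise; $\boldsymbol B^k,\boldsymbol B_0^k$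 are defined identically with $\beta$ in place of $\alpha$. Full-order solution: $\boldsymbol u^k\in\mathbb R^{N_sN_t^k}$ with starting state $\boldsymbol u_0^k$ satisfies $\overline{\boldsymbol r}^k(\boldsymbol u^k;\boldsymbol u_0^k)=\boldsymbol 0$, where $\boldsymbol u_0^0=\boldsymbol u^{\mathrm{init}}$ and, for $k\ge1$, $\boldsymbol u_0^k$ is the last $N_s$-block of $\boldsymbol u^{k-1}$. WST-LSPG solution (windowed space--time least-squares Petrov--Galerkin, no hyper-reduction): computed sequentially for $k=0,\dots,N_w-1$. The starting state is $\tilde{\boldsymbol u}_0^0=\boldsymbol u^{\mathrm{init}}$ and, for $k\ge1$, $\tilde{\boldsymbol u}_0^k$ is the last $N_s$-block of $\tilde{\boldsymbol u}^{k-1}$. Given a basis matrix $\boldsymbol\Pi^k\in\mathbb R^{N_sN_t^k\times n^k}$, the affine trial subspace is $\mathcal S^k=\{\boldsymbol u_{\mathrm{ref}}^k+\boldsymbol\Pi^k\boldsymbol z:\boldsymbol z\in\mathbb R^{n^k}\}$, where $\boldsymbol u_{\mathrm{ref}}^k$ stacks $N_t^k$ copies of $\tilde{\boldsymbol u}_0^k$, and $\tilde{\boldsymbol u}^k\in\mathcal S^k$ is a minimizer of $\boldsymbol w\mapsto\|\overline{\boldsymbol r}^k(\boldsymbol w;\tilde{\boldsymbol u}_0^k)\|_2^2$ over $\mathcal S^k$. *)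

theory Defs
  imports Complex_Main "Jordan_Normal_Form.Char_Poly"
begin

definition norm2 :: "real vec \<Rightarrow> real" where
  "norm2 v = sqrt (v \<bullet> v)"

text \<open>An \<open>m \<times> n\<close> matrix has \<open>min m n\<close> singular values, so the smaller of the two
  Gram matrices is used; otherwise a wide matrix would get a spurious singular value \<open>0\<close>.\<close>

definition singular_values :: "real mat \<Rightarrow> real set" where
  "singular_values A =
     {sqrt l | l. eigenvalue
        (if dim_col A \<le> dim_row A then transpose_mat A * A else A * transpose_mat A) l}"

definition sigma_min :: "real mat \<Rightarrow> real" where
  "sigma_min A = Min (singular_values A)"

definition sigma_max :: "real mat \<Rightarrow> real" where
  "sigma_max A = Max (singular_values A)"

text \<open>In the paper's notation the fields are \<open>N\<^sub>s\<close>, \<open>f\<close>, \<open>u\<^sup>i\<^sup>n\<^sup>i\<^sup>t\<close>, \<open>T\<close>, \<open>N\<^sub>t\<close>, \<open>\<Delta>t\<close>,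
  \<open>n \<mapsto> t\<^sup>n\<close>, \<open>n \<mapsto> s\<^sub>n\<close>, \<open>n j \<mapsto> \<alpha>\<^sub>j\<^sup>n\<close>, \<open>n j \<mapsto> \<beta>\<^sub>j\<^sup>n\<close>, \<open>N\<^sub>w\<close> and \<open>k \<mapsto> N\<^sub>t\<^sup>k\<close>.\<close>

record windowed_lmm =
  sdim :: nat
  rhs :: "real vec \<Rightarrow> real \<Rightarrow> real vec"
  init :: "real vec"
  horizon :: real
  nsteps :: nat
  dt :: real
  time :: "nat \<Rightarrow> real"
  width :: "nat \<Rightarrow> nat"
  alpha :: "nat \<Rightarrow> nat \<Rightarrow> real"
  beta :: "nat \<Rightarrow> nat \<Rightarrow> real"
  nwin :: nat
  wsteps :: "nat \<Rightarrow> nat"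

definition theta :: "windowed_lmm \<Rightarrow> nat \<Rightarrow> nat" where
  "theta M k = 1 + (\<Sum>j<k. wsteps M j)"

definition valid_windowed_lmm :: "windowed_lmm \<Rightarrow> bool" where
  "valid_windowed_lmm M \<longleftrightarrow>
     0 < sdim M \<and>
     (\<forall>w\<in>carrier_vec (sdim M). \<forall>t\<in>{0..horizon M}. rhs M w t \<in> carrier_vec (sdim M)) \<and>
     init M \<in> carrier_vec (sdim M) \<and>
     0 < dt M \<and>
     (\<forall>n<nsteps M. time M (Suc n) = time M n + dt M) \<and>
     0 \<le> time M 0 \<and> time M (nsteps M) \<le> horizon M \<and>
     (\<forall>n\<in>{1..nsteps M}. alpha M n 0 \<noteq> 0 \<and> (\<Sum>j\<le>width M n. alpha M n j) = 0) \<and>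
     (\<Sum>k<nwin M. wsteps M k) = nsteps M \<and>
     (\<forall>k<nwin M. 0 < wsteps M k \<and> width M (theta M k) = 1 \<and>
        (\<forall>l\<in>{1..wsteps M k}. width M (theta M k + l - 1) \<le> l))"

text \<open>\<open>w m\<close> is the state at time step \<open>m\<close>; only \<open>w n, \<dots>, w (n - s\<^sub>n)\<close> enter.\<close>

definition lmm_residual :: "windowed_lmm \<Rightarrow> nat \<Rightarrow> (nat \<Rightarrow> real vec) \<Rightarrow> real vec" where
  "lmm_residual M n w = vec (sdim M) (\<lambda>i.
     (\<Sum>j\<le>width M n. alpha M n j * w (n - j) $ i)
     - dt M * (\<Sum>j\<le>width M n. beta M n j * rhs M (w (n - j)) (time M (n - j)) $ i))"

text \<open>Blocks are numbered from \<open>1\<close>, as in the paper, while vector entries are numbered from \<open>0\<close>: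
  entry \<open>p\<close> of a stacked vector is component \<open>p mod d\<close> of block \<open>p div d + 1\<close>.\<close>

definition stack :: "nat \<Rightarrow> nat \<Rightarrow> (nat \<Rightarrow> real vec) \<Rightarrow> real vec" where
  "stack d m g = vec (d * m) (\<lambda>p. g (p div d + 1) $ (p mod d))"

definition block :: "nat \<Rightarrow> real vec \<Rightarrow> nat \<Rightarrow> real vec" where
  "block d w l = vec d (\<lambda>i. w $ ((l - 1) * d + i))"

definition window_state :: "windowed_lmm \<Rightarrow> nat \<Rightarrow> real vec \<Rightarrow> real vec \<Rightarrow> nat \<Rightarrow> real vec" where
  "window_state M k w w0 n =
     (if n = theta M k - 1 then w0 else block (sdim M) w (n + 1 - theta M k))"

definition windowed_residual :: "windowed_lmm \<Rightarrow> nat \<Rightarrow> real vec \<Rightarrow> real vec \<Rightarrow> real vec" where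
  "windowed_residual M k w w0 =
     stack (sdim M) (wsteps M k)
       (\<lambda>l. lmm_residual M (theta M k + l - 1) (window_state M k w w0))"

definition window_mat :: "windowed_lmm \<Rightarrow> (nat \<Rightarrow> nat \<Rightarrow> real) \<Rightarrow> nat \<Rightarrow> real mat" where
  "window_mat M c k = mat (sdim M * wsteps M k) (sdim M * wsteps M k) (\<lambda>(p, q).
     let l = p div sdim M + 1; l' = q div sdim M + 1; n = theta M k + l - 1 in
     if p mod sdim M = q mod sdim M \<and> l' \<le> l \<and> l - l' \<le> width M n then c n (l - l') else 0)"

definition window_mat0 :: "windowed_lmm \<Rightarrow> (nat \<Rightarrow> nat \<Rightarrow> real) \<Rightarrow> nat \<Rightarrow> real mat" where
  "window_mat0 M c k = mat (sdim M * wsteps M k) (sdim M) (\<lambda>(p, q).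
     let l = p div sdim M + 1; n = theta M k + l - 1 in
     if p mod sdim M = q \<and> width M n = l then c n l else 0)"

abbreviation A_mat :: "windowed_lmm \<Rightarrow> nat \<Rightarrow> real mat" where
  "A_mat M k \<equiv> window_mat M (alpha M) k"

abbreviation B_mat :: "windowed_lmm \<Rightarrow> nat \<Rightarrow> real mat" where
  "B_mat M k \<equiv> window_mat M (beta M) k"

abbreviation A0_mat :: "windowed_lmm \<Rightarrow> nat \<Rightarrow> real mat" where
  "A0_mat M k \<equiv> window_mat0 M (alpha M) k"

abbreviation B0_mat :: "windowed_lmm \<Rightarrow> nat \<Rightarrow> real mat" where
  "B0_mat M k \<equiv> window_mat0 M (beta M) k"

text \<open>The starting state of window \<open>k\<close> for a family \<open>u\<close> of window solutions.\<close>

definition start_state :: "windowed_lmm \<Rightarrow> (nat \<Rightarrow> real vec) \<Rightarrow> nat \<Rightarrow> real vec" where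
  "start_state M u k =
     (if k = 0 then init M else block (sdim M) (u (k - 1)) (wsteps M (k - 1)))"

definition fom_solution :: "windowed_lmm \<Rightarrow> (nat \<Rightarrow> real vec) \<Rightarrow> bool" where
  "fom_solution M u \<longleftrightarrow>
     (\<forall>k<nwin M. u k \<in> carrier_vec (sdim M * wsteps M k) \<and>
        windowed_residual M k (u k) (start_state M u k) = 0\<^sub>v (sdim M * wsteps M k))"

definition trial_space :: "windowed_lmm \<Rightarrow> nat \<Rightarrow> real mat \<Rightarrow> real vec \<Rightarrow> real vec set" where
  "trial_space M k P w0 =
     {stack (sdim M) (wsteps M k) (\<lambda>_. w0) + P *\<^sub>v z | z. z \<in> carrier_vec (dim_col P)}"

definition wst_lspg_solution ::
    "windowed_lmm \<Rightarrow> (nat \<Rightarrow> nat) \<Rightarrow> (nat \<Rightarrow> real mat) \<Rightarrow> (nat \<Rightarrow> real vec) \<Rightarrow> bool" where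
  "wst_lspg_solution M r P u \<longleftrightarrow>
     (\<forall>k<nwin M. P k \<in> carrier_mat (sdim M * wsteps M k) (r k) \<and>
        is_arg_min (\<lambda>w. (norm2 (windowed_residual M k w (start_state M u k)))\<^sup>2)
          (\<lambda>w. w \<in> trial_space M k (P k) (start_state M u k)) (u k))"

end

theory Submission
  imports Defs "HOL-Analysis.Function_Topology" "HOL-Analysis.L2_Norm"
begin

text \<open>The windowed residual is \<open>A w - \<Delta>t B f(w) + A\<^sub>0 w\<^sub>0 - \<Delta>t B\<^sub>0 f(w\<^sub>0)\<close> and vanishes at the
  full-order solution. Subtracting its values at the two solutions expresses \<open>A e\<close> through the
  residual and terms Lipschitz in \<open>e\<close> and \<open>e\<^sub>0\<close>; bounding \<open>\<parallel>A e\<parallel>\<close> from below by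
  \<open>\<sigma>\<^sub>m\<^sub>i\<^sub>n(A) \<parallel>e\<parallel>\<close> and the other terms by maximal singular values gives the estimate.
  The singular value bounds come from the extrema of the Rayleigh quotient of the Gram matrix on
  the compact unit sphere, which are eigenvalues.\<close>

section \<open>Euclidean norm and singular values\<close>

lemma norm2_eq_L2_set: "norm2 v = L2_set (\<lambda>i. v $ i) {..<dim_vec v}"
  by (simp add: norm2_def L2_set_def scalar_prod_def atLeast0LessThan power2_eq_square)

lemma norm2_nonneg [simp]: "0 \<le> norm2 v"
  by (simp add: norm2_eq_L2_set)

lemma norm2_sq: "(norm2 v)\<^sup>2 = v \<bullet> v"
  by (simp add: norm2_def scalar_prod_def sum_nonneg)

lemma norm2_sq_sum: "(norm2 v)\<^sup>2 = (\<Sum>i<dim_vec v. (v $ i)\<^sup>2)"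
  by (simp add: norm2_eq_L2_set L2_set_def sum_nonneg)

lemma norm2_add:
  assumes "v \<in> carrier_vec n" "w \<in> carrier_vec n"
  shows "norm2 (v + w) \<le> norm2 v + norm2 w"
proof -
  have "norm2 (v + w) = L2_set (\<lambda>i. v $ i + w $ i) {..<n}"
    using assms unfolding norm2_eq_L2_set by (intro L2_set_cong) auto
  also have "\<dots> \<le> L2_set (\<lambda>i. v $ i) {..<n} + L2_set (\<lambda>i. w $ i) {..<n}"
    by (rule L2_set_triangle_ineq)
  finally show ?thesis
    using assms by (simp add: norm2_eq_L2_set)
qed

lemma norm2_smult: "norm2 (c \<cdot>\<^sub>v v) = \<bar>c\<bar> * norm2 v"
  by (simp add: norm2_def real_sqrt_mult flip: mult.assoc)

lemma norm2_minus:
  assumes "v \<in> carrier_vec n" "w \<in> carrier_vec n"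
  shows "norm2 (v - w) \<le> norm2 v + norm2 w"
proof -
  have "v - w = v + (-1) \<cdot>\<^sub>v w"
    using assms by auto
  then show ?thesis
    using norm2_add[of v n "(-1) \<cdot>\<^sub>v w"] assms by (simp add: norm2_smult)
qed

section \<open>Extremal eigenvalues of symmetric matrices\<close>

lemma compact_sphere_fun:
  "compact {x :: nat \<Rightarrow> real. (\<forall>i\<ge>n. x i = 0) \<and> (\<Sum>i<n. (x i)\<^sup>2) = 1}" (is "compact ?S")
proof -
  \<comment> \<open>Vectors of length \<open>n\<close> are represented by functions on
    \<open>nat\<close> that vanish from \<open>n\<close> on, which makes the product topology
    available for every \<open>n\<close>. The box \<open>?K\<close> is compact by Tychonoff's
    theorem, and a closed condition cuts the sphere out of it.\<close>
  let ?K = "PiE UNIV (\<lambda>i. if i < n then {-1..1} else {0}) :: (nat \<Rightarrow> real) set"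
  have "compactin (product_topology (\<lambda>_. euclidean) UNIV) ?K"
    by (subst compactin_PiE) auto
  then have "compact ?K"
    by (simp add: euclidean_product_topology)
  moreover have "closed {x :: nat \<Rightarrow> real. (\<Sum>i<n. (x i)\<^sup>2) = 1}"
    by (intro closed_Collect_eq continuous_intros continuous_on_product_coordinates)
  moreover have "?S = ?K \<inter> {x. (\<Sum>i<n. (x i)\<^sup>2) = 1}"
  proof -
    have "\<bar>x i\<bar> \<le> 1" if "(\<Sum>i<n. (x i)\<^sup>2) = 1" "i < n" for x :: "nat \<Rightarrow> real" and i
    proof -
      have "(x i)\<^sup>2 \<le> (\<Sum>i<n. (x i)\<^sup>2)"
        using that by (intro member_le_sum) auto
      then show ?thesis
        using that by (simp add: abs_square_le_1)
    qed
    then show ?thesis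
      by (fastforce simp: PiE_iff abs_le_iff split: if_splits)
  qed
  ultimately show ?thesis
    by (simp add: compact_Int_closed)
qed

text \<open>The quadratic form is continuous, so it attains a maximum on the compact unit sphere.
  Both sides of the inequality are homogeneous of degree two, which extends the bound from the
  sphere to all vectors.\<close>

lemma rayleigh_max_exists:
  fixes G :: "real mat"
  assumes G: "G \<in> carrier_mat n n" and "0 < n"
  obtains v where "v \<in> carrier_vec n" "v \<bullet> v = 1"
    "\<And>w. w \<in> carrier_vec n \<Longrightarrow> w \<bullet> (G *\<^sub>v w) \<le> (v \<bullet> (G *\<^sub>v v)) * (w \<bullet> w)"
proof -
  define S where "S = {x :: nat \<Rightarrow> real. (\<forall>i\<ge>n. x i = 0) \<and> (\<Sum>i<n. (x i)\<^sup>2) = 1}"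
  define q where "q = (\<lambda>x :: nat \<Rightarrow> real. \<Sum>i<n. x i * (\<Sum>j<n. G $$ (i,j) * x j))"
  have form: "vec n x \<bullet> (G *\<^sub>v vec n x) = q x" for x
    using G by (auto simp: q_def scalar_prod_def atLeast0LessThan intro!: sum.cong)
  have norm: "vec n x \<bullet> vec n x = (\<Sum>i<n. (x i)\<^sup>2)" for x :: "nat \<Rightarrow> real"
    by (simp add: scalar_prod_def atLeast0LessThan power2_eq_square)
  \<comment> \<open>The first unit vector, available because \<open>0 < n\<close>, shows that the
    sphere is nonempty.\<close>
  have "(\<Sum>i<n. ((if i = 0 then 1 else 0) :: real)\<^sup>2) = (\<Sum>i<n. if i = 0 then 1 else 0)"
    by (intro sum.cong) auto
  also have "\<dots> = 1"
    using \<open>0 < n\<close> by simp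
  finally have "(\<lambda>i. if i = 0 then 1 else 0) \<in> S"
    using \<open>0 < n\<close> by (auto simp: S_def)
  then have "S \<noteq> {}"
    by blast
  moreover have "continuous_on S q"
    unfolding q_def by (intro continuous_intros continuous_on_subset[OF continuous_on_product_coordinates]) auto
  ultimately obtain x where x: "x \<in> S" and max: "\<And>y. y \<in> S \<Longrightarrow> q y \<le> q x"
    using continuous_attains_sup[of S q] compact_sphere_fun[of n] unfolding S_def[symmetric] by blast
  have "w \<bullet> (G *\<^sub>v w) \<le> q x * (w \<bullet> w)" if w: "w \<in> carrier_vec n" for w
  proof (cases "w \<bullet> w = 0")
    case True
    then have "w = 0\<^sub>v n"
      using w by (simp add: scalar_prod_def sum_nonneg_eq_0_iff) (intro eq_vecI, auto)
    then show ?thesis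
      using G by simp
  next
    case False
    let ?c = "norm2 w"
    have c: "?c > 0"
      using False norm2_sq[of w] norm2_nonneg[of w] by (metis less_eq_real_def power_zero_numeral)
    define y where "y = (\<lambda>i. if i < n then w $ i / ?c else 0)"
    have wy: "w = ?c \<cdot>\<^sub>v vec n y"
      using w c by (intro eq_vecI) (auto simp: y_def)
    have "w \<bullet> w = ?c\<^sup>2 * (\<Sum>i<n. (y i)\<^sup>2)"
      by (subst (1 2) wy) (simp add: norm power2_eq_square)
    then have "y \<in> S"
      using c by (auto simp: S_def y_def norm2_sq[symmetric])
    then have "q y \<le> q x"
      by (rule max)
    moreover have "w \<bullet> (G *\<^sub>v w) = ?c\<^sup>2 * q y"
    proof -
      have "w \<bullet> (G *\<^sub>v w) = (?c \<cdot>\<^sub>v vec n y) \<bullet> (?c \<cdot>\<^sub>v (G *\<^sub>v vec n y))"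
        using wy mult_mat_vec[OF G, of "vec n y" ?c] by simp
      then show ?thesis
        using G by (simp add: form power2_eq_square)
    qed
    ultimately show ?thesis
      using c by (simp add: norm2_sq[symmetric] mult.commute)
  qed
  then show thesis
    using that[of "vec n x"] x by (simp add: form norm S_def)
qed

text \<open>For small negative \<open>t\<close> the linear term dominates, so a positive
  \<open>a\<close> would give a negative value. The witness is \<open>t = - a / (b + 1)\<close>; the
  added 1 keeps the denominator positive when \<open>b = 0\<close>.\<close>

lemma quadratic_nonneg_imp_linear_zero:
  fixes a b :: real
  assumes "\<And>t. 0 \<le> 2 * t * a + t\<^sup>2 * b" "0 \<le> a" "0 \<le> b"
  shows "a = 0"
proof (rule ccontr)
  assume "a \<noteq> 0"
  with assms have a: "a > 0" by simp
  have "0 \<le> 2 * (- a / (b + 1)) * a + (- a / (b + 1))\<^sup>2 * b"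
    by (rule assms)
  also have "\<dots> = - (a\<^sup>2 * (b + 2) / (b + 1)\<^sup>2)"
    using assms(3) by (simp add: divide_simps) (simp add: power2_eq_square algebra_simps)
  also have "\<dots> < 0"
    using a assms(3) by simp
  finally show False by simp
qed

text \<open>A maximizer of the Rayleigh quotient is a critical point, hence an eigenvector, and the
  maximum is its eigenvalue.\<close>

lemma eigenvalue_rayleigh_max:
  fixes G :: "real mat"
  assumes G: "G \<in> carrier_mat n n" and sym: "transpose_mat G = G" and "0 < n"
  obtains \<mu> where "eigenvalue G \<mu>"
    "\<And>w. w \<in> carrier_vec n \<Longrightarrow> w \<bullet> (G *\<^sub>v w) \<le> \<mu> * (w \<bullet> w)"
proof -
  obtain v where v: "v \<in> carrier_vec n" "v \<bullet> v = 1"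
    and max: "\<And>w. w \<in> carrier_vec n \<Longrightarrow> w \<bullet> (G *\<^sub>v w) \<le> (v \<bullet> (G *\<^sub>v v)) * (w \<bullet> w)"
    using rayleigh_max_exists[OF G \<open>0 < n\<close>] by metis
  define \<mu> where "\<mu> = v \<bullet> (G *\<^sub>v v)"
  define w where "w = \<mu> \<cdot>\<^sub>v v - G *\<^sub>v v"
  have Gv: "G *\<^sub>v v \<in> carrier_vec n"
    using G v by simp
  have w: "w \<in> carrier_vec n"
    using v Gv by (simp add: w_def)
  have Gw: "G *\<^sub>v w \<in> carrier_vec n"
    using G w by simp
  \<comment> \<open>Symmetry of \<open>G\<close> merges the two cross terms of the quadratic form at
    \<open>v + t w\<close>.\<close>
  have vGw: "v \<bullet> (G *\<^sub>v w) = w \<bullet> (G *\<^sub>v v)"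
  proof -
    have "v \<bullet> (G *\<^sub>v w) = (transpose_mat G *\<^sub>v v) \<bullet> w"
      using transpose_vec_mult_scalar[OF G w v(1)] by simp
    then show ?thesis
      using comm_scalar_prod[OF Gv w] by (simp add: sym)
  qed
  \<comment> \<open>Only one of the two factors is expanded: the coefficient of \<open>t\<close>
    found below is twice the right-hand side, so it becomes
    \<open>2 * (w \<bullet> w)\<close>.\<close>
  have ww: "w \<bullet> w = \<mu> * (w \<bullet> v) - w \<bullet> (G *\<^sub>v v)"
    by (subst (2) w_def) (use v w Gv in \<open>simp add: scalar_prod_minus_distrib[of _ n]\<close>)
  \<comment> \<open>The form \<open>z \<mapsto> \<mu> z \<bullet> z - z \<bullet> G z\<close> is nonnegative and vanishes at \<open>v\<close>;
    moving from \<open>v\<close> in the direction of its gradient \<open>w\<close> forces \<open>w = 0\<close>.\<close>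
  have "0 \<le> 2 * t * (w \<bullet> w) + t\<^sup>2 * (\<mu> * (w \<bullet> w) - w \<bullet> (G *\<^sub>v w))" for t
  proof -
    let ?y = "v + t \<cdot>\<^sub>v w"
    have y: "?y \<in> carrier_vec n" using v w by simp
    have "G *\<^sub>v ?y = G *\<^sub>v v + t \<cdot>\<^sub>v (G *\<^sub>v w)"
      using G v w by (simp add: mult_add_distrib_mat_vec[OF G] mult_mat_vec[OF G])
    then have yGy: "?y \<bullet> (G *\<^sub>v ?y) = \<mu> + 2 * t * (w \<bullet> (G *\<^sub>v v)) + t\<^sup>2 * (w \<bullet> (G *\<^sub>v w))"
      using v w Gv Gw
      by (simp add: add_scalar_prod_distrib[of _ n] scalar_prod_add_distrib[of _ n] vGw
          \<mu>_def[symmetric] power2_eq_square algebra_simps)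
    have yy: "?y \<bullet> ?y = 1 + 2 * t * (w \<bullet> v) + t\<^sup>2 * (w \<bullet> w)"
      using v w comm_scalar_prod[OF v(1) w]
      by (simp add: add_scalar_prod_distrib[of _ n] scalar_prod_add_distrib[of _ n]
          power2_eq_square algebra_simps)
    have "2 * t * (w \<bullet> w) = 2 * t * (\<mu> * (w \<bullet> v) - w \<bullet> (G *\<^sub>v v))"
      by (simp only: ww)
    then show ?thesis
      using max[OF y] unfolding yGy yy \<mu>_def[symmetric] by (simp add: algebra_simps)
  qed
  moreover have "0 \<le> \<mu> * (w \<bullet> w) - w \<bullet> (G *\<^sub>v w)"
    using max[OF w] by (simp add: \<mu>_def)
  moreover have "0 \<le> w \<bullet> w"
    by (simp flip: norm2_sq)
  ultimately have "w \<bullet> w = 0"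
    using quadratic_nonneg_imp_linear_zero by blast
  then have w0: "w $ i = 0" if "i < n" for i
    using w that by (simp add: scalar_prod_def sum_nonneg_eq_0_iff)
  have "G *\<^sub>v v = \<mu> \<cdot>\<^sub>v v"
  proof (rule eq_vecI)
    fix i assume "i < dim_vec (\<mu> \<cdot>\<^sub>v v)"
    then show "(G *\<^sub>v v) $ i = (\<mu> \<cdot>\<^sub>v v) $ i"
      using w0[of i] v G unfolding w_def by simp
  qed (use G v in auto)
  moreover have "v \<noteq> 0\<^sub>v n"
    using v by auto
  ultimately have "eigenvalue G \<mu>"
    using G v by (auto simp: eigenvalue_def eigenvector_def)
  then show thesis
    using that max by (simp add: \<mu>_def)
qed

text \<open>Negation exchanges the extremes: the maximal Rayleigh value \<open>\<mu>\<close> of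
  \<open>- G\<close> gives the minimal value \<open>- \<mu>\<close> of \<open>G\<close>, with the
  same eigenvector.\<close>

lemma eigenvalue_rayleigh_min:
  fixes G :: "real mat"
  assumes G: "G \<in> carrier_mat n n" and sym: "transpose_mat G = G" and "0 < n"
  obtains \<mu> where "eigenvalue G \<mu>"
    "\<And>w. w \<in> carrier_vec n \<Longrightarrow> \<mu> * (w \<bullet> w) \<le> w \<bullet> (G *\<^sub>v w)"
proof -
  have "transpose_mat (- G) = - G"
    using sym by (metis transpose_uminus)
  then obtain \<mu> where ev: "eigenvalue (- G) \<mu>"
    and max: "\<And>w. w \<in> carrier_vec n \<Longrightarrow> w \<bullet> (- G *\<^sub>v w) \<le> \<mu> * (w \<bullet> w)"
    using eigenvalue_rayleigh_max[of "- G" n] G \<open>0 < n\<close> by auto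
  have neg: "- G *\<^sub>v w = - (G *\<^sub>v w)" if "w \<in> carrier_vec n" for w
    using G that by simp
  obtain v where v: "v \<in> carrier_vec n" "v \<noteq> 0\<^sub>v n" "- G *\<^sub>v v = \<mu> \<cdot>\<^sub>v v"
    using ev G by (auto simp: eigenvalue_def eigenvector_def)
  have "G *\<^sub>v v = - (- G *\<^sub>v v)"
    using neg[OF v(1)] by simp
  then have "G *\<^sub>v v = (- \<mu>) \<cdot>\<^sub>v v"
    unfolding v(3) by auto
  then have "eigenvalue G (- \<mu>)"
    using G v by (auto simp: eigenvalue_def eigenvector_def)
  moreover have "- \<mu> * (w \<bullet> w) \<le> w \<bullet> (G *\<^sub>v w)" if "w \<in> carrier_vec n" for w
    using max[OF that] G that by (simp add: neg)
  ultimately show thesis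
    using that by blast
qed

section \<open>Singular values as bounds on the action of a matrix\<close>

lemma finite_singular_values: "finite (singular_values A)"
proof -
  define G where "G = (if dim_col A \<le> dim_row A then transpose_mat A * A else A * transpose_mat A)"
  have G: "G \<in> carrier_mat (dim_row G) (dim_row G)"
    by (auto simp: G_def)
  \<comment> \<open>Eigenvalues are the roots of a nonzero polynomial. Finiteness is what allows
    \<open>Min\<close> and \<open>Max\<close> in \<open>sigma_min\<close> and
    \<open>sigma_max\<close> to be compared with a given singular value.\<close>
  have "char_poly G \<noteq> 0"
    using degree_monic_char_poly[OF G] by auto
  then have "finite {l. eigenvalue G l}"
    using poly_roots_finite by (simp add: eigenvalue_root_char_poly[OF G])
  moreover have "singular_values A = sqrt ` {l. eigenvalue G l}"
    by (auto simp: singular_values_def G_def)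
  ultimately show ?thesis
    by simp
qed

lemma gram_scalar_prod:
  fixes A :: "real mat"
  assumes A: "A \<in> carrier_mat m n" and v: "v \<in> carrier_vec n"
  shows "v \<bullet> (transpose_mat A * A *\<^sub>v v) = (norm2 (A *\<^sub>v v))\<^sup>2"
proof -
  have Av: "A *\<^sub>v v \<in> carrier_vec m"
    using assms by simp
  have "v \<bullet> (transpose_mat A * A *\<^sub>v v) = v \<bullet> (transpose_mat A *\<^sub>v (A *\<^sub>v v))"
    using assms by (simp add: assoc_mult_mat_vec[of _ n m _ n])
  also have "\<dots> = (A *\<^sub>v v) \<bullet> (A *\<^sub>v v)"
    using transpose_vec_mult_scalar[OF A v Av] comm_scalar_prod[of v n "transpose_mat A *\<^sub>v (A *\<^sub>v v)"] A v Av
    by simp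
  finally show ?thesis
    by (simp add: norm2_sq)
qed

text \<open>With \<open>n \<le> m\<close> the singular values come from
  \<open>transpose_mat A * A\<close>, whose Rayleigh quotient at \<open>v\<close> is the squared
  ratio of \<open>norm2 (A *\<^sub>v v)\<close> to \<open>norm2 v\<close>. Its maximum is an
  eigenvalue, so the root of it is a singular value.\<close>

lemma norm2_mult_le_sigma_max:
  assumes A: "A \<in> carrier_mat m n" and "0 < n" "n \<le> m" and v: "v \<in> carrier_vec n"
  shows "norm2 (A *\<^sub>v v) \<le> sigma_max A * norm2 v"
proof -
  have "transpose_mat (transpose_mat A * A) = transpose_mat A * A"
    using A by (simp add: transpose_mult[of _ n m _ n])
  then obtain \<mu> where ev: "eigenvalue (transpose_mat A * A) \<mu>"
    and bd: "\<And>w. w \<in> carrier_vec n \<Longrightarrow> w \<bullet> (transpose_mat A * A *\<^sub>v w) \<le> \<mu> * (w \<bullet> w)"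
    using eigenvalue_rayleigh_max[of "transpose_mat A * A" n] A \<open>0 < n\<close> by auto
  have "sqrt \<mu> \<in> singular_values A"
    using ev A \<open>n \<le> m\<close> by (auto simp: singular_values_def)
  then have "sqrt \<mu> \<le> sigma_max A"
    by (simp add: sigma_max_def finite_singular_values)
  have "(norm2 (A *\<^sub>v v))\<^sup>2 \<le> \<mu> * (norm2 v)\<^sup>2"
    using bd[OF v] by (simp add: gram_scalar_prod[OF A v] norm2_sq)
  then have "norm2 (A *\<^sub>v v) \<le> sqrt (\<mu> * (norm2 v)\<^sup>2)"
    by (rule real_le_rsqrt)
  \<comment> \<open>\<open>sqrt\<close> is extended to negative arguments as an odd function and is
    multiplicative on all reals, so this holds whatever the sign of \<open>\<mu>\<close>.\<close>
  also have "\<dots> = sqrt \<mu> * norm2 v"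
    by (simp add: real_sqrt_mult)
  also have "\<dots> \<le> sigma_max A * norm2 v"
    using \<open>sqrt \<mu> \<le> sigma_max A\<close> by (simp add: mult_right_mono)
  finally show ?thesis .
qed

lemma sigma_min_mult_norm2_le:
  assumes A: "A \<in> carrier_mat m n" and "0 < n" "n \<le> m" and v: "v \<in> carrier_vec n"
  shows "sigma_min A * norm2 v \<le> norm2 (A *\<^sub>v v)"
proof -
  have "transpose_mat (transpose_mat A * A) = transpose_mat A * A"
    using A by (simp add: transpose_mult[of _ n m _ n])
  then obtain \<mu> where ev: "eigenvalue (transpose_mat A * A) \<mu>"
    and bd: "\<And>w. w \<in> carrier_vec n \<Longrightarrow> \<mu> * (w \<bullet> w) \<le> w \<bullet> (transpose_mat A * A *\<^sub>v w)"
    using eigenvalue_rayleigh_min[of "transpose_mat A * A" n] A \<open>0 < n\<close> by auto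
  have "sqrt \<mu> \<in> singular_values A"
    using ev A \<open>n \<le> m\<close> by (auto simp: singular_values_def)
  then have "sigma_min A \<le> sqrt \<mu>"
    by (simp add: sigma_min_def finite_singular_values)
  then have "sigma_min A * norm2 v \<le> sqrt \<mu> * norm2 v"
    by (simp add: mult_right_mono)
  also have "\<dots> = sqrt (\<mu> * (norm2 v)\<^sup>2)"
    by (simp add: real_sqrt_mult)
  also have "\<dots> \<le> norm2 (A *\<^sub>v v)"
    using bd[OF v] by (intro real_le_lsqrt) (simp_all add: gram_scalar_prod[OF A v] norm2_sq)
  finally show ?thesis .
qed

text \<open>Testing the upper bound on a unit vector gives the sign, which is needed later to
  multiply Lipschitz bounds by \<open>sigma_max\<close>.\<close>

lemma sigma_max_nonneg:
  assumes A: "A \<in> carrier_mat m n" and "0 < n" "n \<le> m"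
  shows "0 \<le> sigma_max A"
proof -
  have "norm2 (unit_vec n 0) = 1"
    using \<open>0 < n\<close> by (simp add: norm2_def)
  then show ?thesis
    using norm2_mult_le_sigma_max[OF assms, of "unit_vec n 0"] norm2_nonneg[of "A *\<^sub>v unit_vec n 0"]
    by (smt (verit) mult_cancel_left1 mult.right_neutral unit_vec_carrier)
qed

section \<open>Block structure of the windowed residual\<close>

text \<open>The substitution \<open>p = l * d + i\<close> splits a sum over the entries of a stacked
  vector into blocks and components.\<close>

lemma sum_div_mod:
  fixes g :: "nat \<Rightarrow> nat \<Rightarrow> 'a :: comm_monoid_add"
  shows "(\<Sum>p<d * m. g (p div d) (p mod d)) = (\<Sum>l<m. \<Sum>i<d. g l i)"
proof -
  have "(\<Sum>p\<in>{l * d..<l * d + d}. g (p div d) (p mod d)) = (\<Sum>i<d. g l i)" for l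
  proof -
    have "(\<Sum>p\<in>{l * d..<l * d + d}. g (p div d) (p mod d))
        = (\<Sum>i<d. g ((i + l * d) div d) ((i + l * d) mod d))"
      using sum.shift_bounds_nat_ivl[of "\<lambda>p. g (p div d) (p mod d)" 0 "l * d" d]
      by (simp add: atLeast0LessThan add.commute)
    also have "\<dots> = (\<Sum>i<d. g l i)"
      by (intro sum.cong) auto
    finally show ?thesis .
  qed
  then show ?thesis
    using sum.nat_group[of "\<lambda>p. g (p div d) (p mod d)" d m] by (simp add: mult.commute)
qed

lemma block_carrier [simp]: "block d w l \<in> carrier_vec d"
  by (simp add: block_def)

lemma stack_carrier [simp]: "stack d m g \<in> carrier_vec (d * m)"
  by (simp add: stack_def)

lemma block_index_less:
  assumes "l < m" "i < d"
  shows "l * d + i < d * (m :: nat)"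
proof -
  have "l * d + i < Suc l * d"
    using assms by simp
  also have "\<dots> \<le> m * d"
    using assms by (intro mult_right_mono) auto
  finally show ?thesis
    by (simp add: mult.commute)
qed

lemma block_stack:
  assumes "g l \<in> carrier_vec d" "1 \<le> l" "l \<le> m"
  shows "block d (stack d m g) l = g l"
  using assms block_index_less[of "l - 1" m _ d] by (intro eq_vecI) (auto simp: block_def stack_def)

lemma block_minus:
  assumes "x \<in> carrier_vec (d * m)" "y \<in> carrier_vec (d * m)" "1 \<le> l" "l \<le> m"
  shows "block d (x - y) l = block d x l - block d y l"
  using assms block_index_less[of "l - 1" m _ d] by (intro eq_vecI) (auto simp: block_def)

lemma norm2_sq_blocks:
  assumes "x \<in> carrier_vec (d * m)"
  shows "(norm2 x)\<^sup>2 = (\<Sum>l<m. (norm2 (block d x (l + 1)))\<^sup>2)"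
proof -
  \<comment> \<open>The index \<open>p\<close> is rewritten as quotient and remainder so that
    \<open>sum_div_mod\<close> matches.\<close>
  have "(norm2 x)\<^sup>2 = (\<Sum>p<d * m. (x $ (p div d * d + p mod d))\<^sup>2)"
    using assms by (simp add: norm2_sq_sum)
  also have "\<dots> = (\<Sum>l<m. \<Sum>i<d. (x $ (l * d + i))\<^sup>2)"
    by (rule sum_div_mod)
  finally show ?thesis
    by (simp add: norm2_sq_sum block_def)
qed

text \<open>Squared norms add over blocks, so a bound with the same constant on every block passes
  to the whole vector.\<close>

lemma norm2_le_blockwise:
  assumes "x \<in> carrier_vec (d * m)" "y \<in> carrier_vec (d * m)" "0 \<le> \<kappa>"
    and "\<And>l. 1 \<le> l \<Longrightarrow> l \<le> m \<Longrightarrow> norm2 (block d x l) \<le> \<kappa> * norm2 (block d y l)"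
  shows "norm2 x \<le> \<kappa> * norm2 y"
proof (rule power2_le_imp_le)
  have "(\<Sum>l<m. (norm2 (block d x (l + 1)))\<^sup>2) \<le> (\<Sum>l<m. (\<kappa> * norm2 (block d y (l + 1)))\<^sup>2)"
    using assms(4) by (intro sum_mono power_mono) auto
  then show "(norm2 x)\<^sup>2 \<le> (\<kappa> * norm2 y)\<^sup>2"
    by (simp add: norm2_sq_blocks[OF assms(1)] norm2_sq_blocks[OF assms(2)] power_mult_distrib
        sum_distrib_left)
  show "0 \<le> \<kappa> * norm2 y"
    using assms(3) by simp
qed

lemma window_mat_carrier [simp]:
  "window_mat M c k \<in> carrier_mat (sdim M * wsteps M k) (sdim M * wsteps M k)"
  by (simp add: window_mat_def)

lemma window_mat0_carrier [simp]:
  "window_mat0 M c k \<in> carrier_mat (sdim M * wsteps M k) (sdim M)"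
  by (simp add: window_mat0_def)

text \<open>Each block is a multiple of the identity, so only component \<open>p mod d\<close> of
  every block survives. Passing from the column block to the lag \<open>j\<close> turns the row into
  the part of the multistep stencil that stays inside the window.\<close>

lemma window_mat_mult_index:
  fixes M :: windowed_lmm
  defines "d \<equiv> sdim M"
  assumes x: "x \<in> carrier_vec (d * wsteps M k)" and p: "p < d * wsteps M k"
    and l: "l = p div d + 1" and n: "n = theta M k + l - 1"
  shows "(window_mat M c k *\<^sub>v x) $ p =
    (\<Sum>j | j \<le> width M n \<and> j < l. c n j * block d x (l - j) $ (p mod d))"
proof -
  let ?m = "wsteps M k" and ?i = "p mod d"
  have d: "0 < d"
    using p by (cases d) auto
  have lm: "l \<le> ?m"
    using p less_mult_imp_div_less[of p ?m d] by (simp add: l mult.commute)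
  \<comment> \<open>Here \<open>l'\<close> counts column blocks from 0, so the block number is
    \<open>l' + 1\<close> and the lag is \<open>l - (l' + 1)\<close>.\<close>
  let ?P = "\<lambda>l'. l' + 1 \<le> l \<and> l - (l' + 1) \<le> width M n"
  have "(window_mat M c k *\<^sub>v x) $ p = (\<Sum>q<d * ?m. window_mat M c k $$ (p, q) * x $ q)"
    using x p by (simp add: window_mat_def scalar_prod_def atLeast0LessThan d_def)
  also have "\<dots> = (\<Sum>q<d * ?m. if ?i = q mod d \<and> ?P (q div d)
      then c n (l - (q div d + 1)) * x $ (q div d * d + q mod d) else 0)"
    using p by (intro sum.cong) (auto simp: window_mat_def Let_def d_def l n)
  also have "\<dots> = (\<Sum>l'<?m. \<Sum>i<d. if ?i = i \<and> ?P l'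
      then c n (l - (l' + 1)) * x $ (l' * d + i) else 0)"
    by (rule sum_div_mod)
  also have "\<dots> = (\<Sum>l'<?m. if ?P l' then c n (l - (l' + 1)) * x $ (l' * d + ?i) else 0)"
  proof (rule sum.cong[OF refl])
    fix l'
    have "(\<Sum>i<d. if ?i = i \<and> ?P l' then c n (l - (l' + 1)) * x $ (l' * d + i) else 0)
      = (\<Sum>i<d. if ?i = i then (if ?P l' then c n (l - (l' + 1)) * x $ (l' * d + i) else 0) else 0)"
      by (intro sum.cong) auto
    then show "(\<Sum>i<d. if ?i = i \<and> ?P l' then c n (l - (l' + 1)) * x $ (l' * d + i) else 0)
      = (if ?P l' then c n (l - (l' + 1)) * x $ (l' * d + ?i) else 0)"
      using d by simp
  qed
  also have "\<dots> = (\<Sum>l'\<in>{l' \<in> {..<?m}. ?P l'}. c n (l - (l' + 1)) * x $ (l' * d + ?i))"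
    by (rule sum.inter_filter[symmetric]) simp
  also have "\<dots> = (\<Sum>j | j \<le> width M n \<and> j < l. c n j * block d x (l - j) $ ?i)"
    using d lm
    by (intro sum.reindex_bij_witness[of _ "\<lambda>j. l - (j + 1)" "\<lambda>l'. l - (l' + 1)"])
      (auto simp: block_def)
  finally show ?thesis .
qed

lemma window_mat0_mult_index:
  fixes M :: windowed_lmm
  defines "d \<equiv> sdim M"
  assumes x: "x0 \<in> carrier_vec d" and p: "p < d * wsteps M k"
    and l: "l = p div d + 1" and n: "n = theta M k + l - 1"
  shows "(window_mat0 M c k *\<^sub>v x0) $ p =
    (if width M n = l then c n l * x0 $ (p mod d) else 0)"
proof -
  have d: "0 < d"
    using p by (cases d) auto
  have "(window_mat0 M c k *\<^sub>v x0) $ p = (\<Sum>q<d. window_mat0 M c k $$ (p, q) * x0 $ q)"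
    using x p by (simp add: window_mat0_def scalar_prod_def atLeast0LessThan d_def)
  also have "\<dots> = (\<Sum>q<d. if p mod d = q then (if width M n = l then c n l * x0 $ q else 0) else 0)"
    using p by (intro sum.cong) (auto simp: window_mat0_def Let_def d_def l n)
  finally show ?thesis
    using d by simp
qed

text \<open>Since the width is at most \<open>l\<close>, only the lag \<open>j = l\<close> can reach
  the starting state. The lags \<open>j < l\<close> come from \<open>window_mat\<close> and the lag
  \<open>j = l\<close> from \<open>window_mat0\<close>; together they form the full stencil.\<close>

lemma window_mat_add_window_mat0_index:
  fixes M :: windowed_lmm
  defines "d \<equiv> sdim M"
  assumes x: "x \<in> carrier_vec (d * wsteps M k)" "x0 \<in> carrier_vec d" and p: "p < d * wsteps M k"
    and l: "l = p div d + 1" and n: "n = theta M k + l - 1" and width: "width M n \<le> l"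
  shows "(window_mat M c k *\<^sub>v x + window_mat0 M c k *\<^sub>v x0) $ p =
    (\<Sum>j\<le>width M n. c n j * (if j = l then x0 else block d x (l - j)) $ (p mod d))"
proof -
  let ?g = "\<lambda>j. c n j * (if j = l then x0 else block d x (l - j)) $ (p mod d)"
  have "(\<Sum>j\<le>width M n. ?g j) =
      (\<Sum>j | j \<le> width M n \<and> j < l. ?g j) + (if width M n = l then c n l * x0 $ (p mod d) else 0)"
  proof (cases "width M n = l")
    case True
    then have "{..width M n} = insert l {j. j \<le> width M n \<and> j < l}"
      by auto
    then show ?thesis
      using True by simp
  next
    case False
    then have "{..width M n} = {j. j \<le> width M n \<and> j < l}"
      using width by auto
    then show ?thesis
      using False by simp
  qed
  also have "(\<Sum>j | j \<le> width M n \<and> j < l. ?g j) =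
      (\<Sum>j | j \<le> width M n \<and> j < l. c n j * block d x (l - j) $ (p mod d))"
    by (intro sum.cong) auto
  finally show ?thesis
    using p window_mat_mult_index[of x M k p l n c] window_mat0_mult_index[of x0 M p k l n c] x l n
    by (simp add: d_def window_mat0_def)
qed

section \<open>Matrix form of the windowed residual\<close>

definition window_rhs :: "windowed_lmm \<Rightarrow> nat \<Rightarrow> real vec \<Rightarrow> real vec" where
  "window_rhs M k w =
     stack (sdim M) (wsteps M k) (\<lambda>l. rhs M (block (sdim M) w l) (time M (theta M k + l - 1)))"

lemma theta_ge_1: "1 \<le> theta M k"
  by (simp add: theta_def)

text \<open>The constant step makes the time grid increasing, and the windows exhaust exactly
  \<open>nsteps M\<close> steps. The case \<open>l = 0\<close> covers the time of the starting
  state.\<close>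

lemma time_in_horizon:
  assumes M: "valid_windowed_lmm M" and k: "k < nwin M" and l: "l \<le> wsteps M k"
  shows "time M (theta M k + l - 1) \<in> {0..horizon M}"
proof -
  have time: "time M n = time M 0 + real n * dt M" if "n \<le> nsteps M" for n
    using that
  proof (induction n)
    case (Suc n)
    then show ?case
      using M by (simp add: valid_windowed_lmm_def algebra_simps)
  qed simp
  have "theta M k + l - 1 \<le> (\<Sum>j<Suc k. wsteps M j)"
    using l by (simp add: theta_def)
  also have "\<dots> \<le> (\<Sum>j<nwin M. wsteps M j)"
    using k by (intro sum_mono2) auto
  also have "\<dots> = nsteps M"
    using M by (simp add: valid_windowed_lmm_def)
  finally have le: "theta M k + l - 1 \<le> nsteps M" .
  have dt: "0 < dt M"
    using M by (simp add: valid_windowed_lmm_def)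
  have "time M (theta M k + l - 1) \<le> time M (nsteps M)"
    unfolding time[OF le] time[OF order_refl] using le dt by (simp add: mult_right_mono)
  moreover have "time M 0 \<le> time M (theta M k + l - 1)"
    unfolding time[OF le] using dt by simp
  ultimately show ?thesis
    using M by (simp add: valid_windowed_lmm_def)
qed

lemma rhs_carrier:
  assumes "valid_windowed_lmm M" "k < nwin M" "l \<le> wsteps M k" "w \<in> carrier_vec (sdim M)"
  shows "rhs M w (time M (theta M k + l - 1)) \<in> carrier_vec (sdim M)"
  using assms time_in_horizon[OF assms(1-3)] by (auto simp: valid_windowed_lmm_def)

lemma block_window_rhs:
  assumes "valid_windowed_lmm M" "k < nwin M" "1 \<le> l" "l \<le> wsteps M k"
  shows "block (sdim M) (window_rhs M k w) l =
    rhs M (block (sdim M) w l) (time M (theta M k + l - 1))"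
  unfolding window_rhs_def
  using assms by (intro block_stack rhs_carrier) auto

text \<open>Entry \<open>p\<close> of either side belongs to component \<open>i\<close> of step
  \<open>n\<close>. The two stencil sums of the residual, over states and over right-hand sides,
  match the two matrix expressions lag by lag.\<close>

lemma windowed_residual_eq:
  assumes M: "valid_windowed_lmm M" and k: "k < nwin M"
    and w: "w \<in> carrier_vec (sdim M * wsteps M k)" and w0: "w0 \<in> carrier_vec (sdim M)"
  shows "windowed_residual M k w w0 =
    (A_mat M k *\<^sub>v w + A0_mat M k *\<^sub>v w0)
    - dt M \<cdot>\<^sub>v (B_mat M k *\<^sub>v window_rhs M k w + B0_mat M k *\<^sub>v rhs M w0 (time M (theta M k - 1)))"
    (is "_ = ?A - dt M \<cdot>\<^sub>v ?B")
proof (rule eq_vecI)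
  let ?d = "sdim M" and ?m = "wsteps M k"
  have dims: "dim_vec ?A = ?d * ?m" "dim_vec ?B = ?d * ?m"
    by (simp_all add: window_mat0_def)
  show "dim_vec (windowed_residual M k w w0) = dim_vec (?A - dt M \<cdot>\<^sub>v ?B)"
    by (simp add: windowed_residual_def stack_def dims window_mat0_def)
  fix p assume "p < dim_vec (?A - dt M \<cdot>\<^sub>v ?B)"
  then have p: "p < ?d * ?m"
    by (simp add: window_mat0_def)
  define l where "l = p div ?d + 1"
  define n where "n = theta M k + l - 1"
  define i where "i = p mod ?d"
  have lm: "1 \<le> l" "l \<le> ?m"
    using p less_mult_imp_div_less[of p ?m ?d] by (simp_all add: l_def mult.commute)
  have width: "width M n \<le> l"
    using M k lm by (simp add: valid_windowed_lmm_def n_def)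
  have i: "i < ?d"
    using M by (simp add: i_def valid_windowed_lmm_def)
  have f0: "rhs M w0 (time M (theta M k - 1)) \<in> carrier_vec ?d"
    using rhs_carrier[OF M k _ w0, of 0] by simp
  \<comment> \<open>Because \<open>j \<le> l\<close>, the truncated subtractions are exact, and step
    \<open>n - j\<close> is the starting step precisely when \<open>j = l\<close>.\<close>
  have state: "window_state M k w w0 (n - j) = (if j = l then w0 else block ?d w (l - j))"
    if "j \<le> width M n" for j
  proof -
    have "j \<le> l"
      using that width by simp
    moreover have "n - j + 1 - theta M k = l - j"
      using \<open>j \<le> l\<close> theta_ge_1[of M k] lm by (simp add: n_def)
    moreover have "n - j = theta M k - 1 \<longleftrightarrow> j = l"
      using \<open>j \<le> l\<close> theta_ge_1[of M k] lm by (auto simp: n_def)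
    ultimately show ?thesis
      by (simp add: window_state_def)
  qed
  have rhs_state: "rhs M (if j = l then w0 else block ?d w (l - j)) (time M (n - j)) =
      (if j = l then rhs M w0 (time M (theta M k - 1)) else block ?d (window_rhs M k w) (l - j))"
    if "j \<le> width M n" for j
  proof (cases "j = l")
    case True
    then show ?thesis
      using lm by (simp add: n_def)
  next
    case False
    then have "j < l"
      using that width by simp
    then have "n - j = theta M k + (l - j) - 1"
      using theta_ge_1[of M k] by (simp add: n_def)
    then show ?thesis
      using block_window_rhs[OF M k, of "l - j" w] \<open>j < l\<close> lm by simp
  qed
  have "windowed_residual M k w w0 $ p = lmm_residual M n (window_state M k w w0) $ i"
    using p by (simp add: windowed_residual_def stack_def l_def n_def i_def)
  also have "\<dots> = (\<Sum>j\<le>width M n. alpha M n j * (if j = l then w0 else block ?d w (l - j)) $ i)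
      - dt M * (\<Sum>j\<le>width M n. beta M n j * (if j = l then rhs M w0 (time M (theta M k - 1))
          else block ?d (window_rhs M k w) (l - j)) $ i)"
    using i by (simp add: lmm_residual_def state rhs_state)
  also have "\<dots> = ?A $ p - dt M * ?B $ p"
    using window_mat_add_window_mat0_index[OF w w0 p l_def n_def width, of "alpha M"]
      window_mat_add_window_mat0_index[OF _ f0 p l_def n_def width, of "window_rhs M k w" "beta M"]
    by (simp add: i_def window_rhs_def)
  finally show "windowed_residual M k w w0 $ p = (?A - dt M \<cdot>\<^sub>v ?B) $ p"
    using p dims by simp
qed

section \<open>The error estimate\<close>

lemma start_state_carrier:
  "valid_windowed_lmm M \<Longrightarrow> start_state M u k \<in> carrier_vec (sdim M)"
  by (simp add: start_state_def valid_windowed_lmm_def)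

lemma wst_lspg_solution_carrier:
  assumes "wst_lspg_solution M r P u" "k < nwin M"
  shows "u k \<in> carrier_vec (sdim M * wsteps M k)"
  using assms by (force simp: wst_lspg_solution_def is_arg_min_def trial_space_def)

text \<open>Corresponding blocks evaluate the right-hand side at the same time inside the horizon,
  so the pointwise Lipschitz bound holds blockwise and the constant is preserved.\<close>

lemma window_rhs_lipschitz:
  assumes M: "valid_windowed_lmm M" and k: "k < nwin M" and "0 \<le> \<kappa>"
    and lip: "\<forall>w\<in>carrier_vec (sdim M). \<forall>y\<in>carrier_vec (sdim M). \<forall>t\<in>{0..horizon M}.
          norm2 (rhs M w t - rhs M y t) \<le> \<kappa> * norm2 (w - y)"
    and w: "w \<in> carrier_vec (sdim M * wsteps M k)" and y: "y \<in> carrier_vec (sdim M * wsteps M k)"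
  shows "norm2 (window_rhs M k w - window_rhs M k y) \<le> \<kappa> * norm2 (w - y)"
proof (rule norm2_le_blockwise[where d = "sdim M" and m = "wsteps M k"])
  have F: "window_rhs M k v \<in> carrier_vec (sdim M * wsteps M k)" for v
    by (simp add: window_rhs_def)
  then show "window_rhs M k w - window_rhs M k y \<in> carrier_vec (sdim M * wsteps M k)"
    by simp
  show "w - y \<in> carrier_vec (sdim M * wsteps M k)"
    using w y by simp
  fix l assume l: "1 \<le> l" "l \<le> wsteps M k"
  show "norm2 (block (sdim M) (window_rhs M k w - window_rhs M k y) l)
      \<le> \<kappa> * norm2 (block (sdim M) (w - y) l)"
    using lip time_in_horizon[OF M k l(2)]
    by (simp add: block_minus[OF F F l] block_minus[OF w y l] block_window_rhs[OF M k l])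
qed fact

theorem corollary6p2p1:
  fixes M :: windowed_lmm
    and u ut :: "nat \<Rightarrow> real vec"
    and r :: "nat \<Rightarrow> nat"
    and P :: "nat \<Rightarrow> real mat"
    and \<kappa> :: real
    and k :: nat
  assumes "valid_windowed_lmm M"
    and "fom_solution M u"
    and "wst_lspg_solution M r P ut"
    and "k < nwin M"
    and "0 < \<kappa>"
    and A1: "\<forall>w\<in>carrier_vec (sdim M). \<forall>y\<in>carrier_vec (sdim M). \<forall>t\<in>{0..horizon M}.
          norm2 (rhs M w t - rhs M y t) \<le> \<kappa> * norm2 (w - y)"
    and A2: "sigma_min (A_mat M k) - sigma_max (B_mat M k) * dt M * \<kappa> > 0"
  shows "let e = ut k - u k;
             e0 = start_state M ut k - start_state M u k;
             a = sigma_min (A_mat M k) - sigma_max (B_mat M k) * dt M * \<kappa>;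
             b = sigma_max (A0_mat M k) + dt M * \<kappa> * sigma_max (B0_mat M k)
         in norm2 e \<le> 1 / a * norm2 (windowed_residual M k (ut k) (start_state M ut k))
                      + b / a * norm2 e0"
proof -
  note M = assms(1) and k = assms(4)
  let ?d = "sdim M" and ?N = "sdim M * wsteps M k"
  let ?A = "A_mat M k" and ?B = "B_mat M k" and ?Ai = "A0_mat M k" and ?Bi = "B0_mat M k"
  define v v0 where "v = ut k" and "v0 = start_state M ut k"
  define y y0 where "y = u k" and "y0 = start_state M u k"
  define Fv Fy where "Fv = window_rhs M k v" and "Fy = window_rhs M k y"
  define f0v f0y where "f0v = rhs M v0 (time M (theta M k - 1))"
    and "f0y = rhs M y0 (time M (theta M k - 1))"
  define \<rho> where "\<rho> = windowed_residual M k v v0"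
  define \<tau> where "\<tau> = dt M"
  have pos: "0 < ?d" "0 < wsteps M k" "0 < \<tau>"
    using M k by (auto simp: valid_windowed_lmm_def \<tau>_def)
  \<comment> \<open>\<open>?d \<le> ?N\<close> makes \<open>?Ai\<close> and \<open>?Bi\<close> tall,
    as the bounds by \<open>sigma_max\<close> require.\<close>
  then have N: "0 < ?N" "?d \<le> ?N"
    by auto
  have c: "v \<in> carrier_vec ?N" "y \<in> carrier_vec ?N" "Fv \<in> carrier_vec ?N" "Fy \<in> carrier_vec ?N"
    using wst_lspg_solution_carrier[OF assms(3) k] assms(2) k
    by (auto simp: v_def y_def Fv_def Fy_def window_rhs_def fom_solution_def)
  have c0: "v0 \<in> carrier_vec ?d" "y0 \<in> carrier_vec ?d"
    using M by (simp_all add: v0_def y0_def start_state_carrier)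
  have cf: "f0v \<in> carrier_vec ?d" "f0y \<in> carrier_vec ?d"
    using rhs_carrier[OF M k, of 0] c0 by (simp_all add: f0v_def f0y_def)
  have res_v: "\<rho> = (?A *\<^sub>v v + ?Ai *\<^sub>v v0) - \<tau> \<cdot>\<^sub>v (?B *\<^sub>v Fv + ?Bi *\<^sub>v f0v)"
    unfolding \<rho>_def \<tau>_def Fv_def f0v_def by (rule windowed_residual_eq[OF M k c(1) c0(1)])
  have res_y: "0\<^sub>v ?N = (?A *\<^sub>v y + ?Ai *\<^sub>v y0) - \<tau> \<cdot>\<^sub>v (?B *\<^sub>v Fy + ?Bi *\<^sub>v f0y)"
    using windowed_residual_eq[OF M k c(2) c0(2)] assms(2) k
    by (simp add: fom_solution_def \<tau>_def Fy_def f0y_def y_def y0_def)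
  let ?Ae = "?A *\<^sub>v (v - y)" and ?Bf = "?B *\<^sub>v (Fv - Fy)"
    and ?Aie = "?Ai *\<^sub>v (v0 - y0)" and ?Bif = "?Bi *\<^sub>v (f0v - f0y)"
  have cm: "X *\<^sub>v z \<in> carrier_vec ?N" if "X \<in> carrier_mat ?N q" for X :: "real mat" and z q
    by (rule carrier_vecI) (simp only: dim_mult_mat_vec carrier_matD(1)[OF that])
  have \<rho>: "\<rho> \<in> carrier_vec ?N"
    unfolding res_v by (intro minus_carrier_vec smult_carrier_vec[THEN iffD2] add_carrier_vec
      cm[OF window_mat_carrier] cm[OF window_mat0_carrier])
  \<comment> \<open>The error equation: subtract \<open>res_y\<close>, where the residual is zero,
    from \<open>res_v\<close> and solve for the term with \<open>?A\<close>.\<close>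
  have "?Ae = (\<rho> + \<tau> \<cdot>\<^sub>v ?Bf) - (?Aie - \<tau> \<cdot>\<^sub>v ?Bif)"
  proof (rule eq_vecI)
    fix p assume "p < dim_vec ((\<rho> + \<tau> \<cdot>\<^sub>v ?Bf) - (?Aie - \<tau> \<cdot>\<^sub>v ?Bif))"
    then have p: "p < ?N"
      by (simp add: window_mat0_def)
    \<comment> \<open>Entries of matrix-vector products are kept as atoms, so the error equation
      reduces to linear arithmetic in them.\<close>
    have diff: "(X *\<^sub>v (a - b)) $ p = (X *\<^sub>v a) $ p - (X *\<^sub>v b) $ p"
      if "X \<in> carrier_mat ?N q" "a \<in> carrier_vec q" "b \<in> carrier_vec q" for X :: "real mat" and a b q
      using that p by (simp add: mult_minus_distrib_mat_vec[OF that])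
    have dims: "dim_row ?A = ?N" "dim_row ?Ai = ?N" "dim_row ?B = ?N" "dim_row ?Bi = ?N"
      by (simp_all add: window_mat_def window_mat0_def)
    have "\<rho> $ p = (?A *\<^sub>v v) $ p + (?Ai *\<^sub>v v0) $ p - \<tau> * ((?B *\<^sub>v Fv) $ p + (?Bi *\<^sub>v f0v) $ p)"
      unfolding res_v using p dims by (simp del: index_mult_mat_vec)
    moreover have "0 = (?A *\<^sub>v y) $ p + (?Ai *\<^sub>v y0) $ p - \<tau> * ((?B *\<^sub>v Fy) $ p + (?Bi *\<^sub>v f0y) $ p)"
      using arg_cong[OF res_y, of "\<lambda>z. z $ p"] p dims by (simp del: index_mult_mat_vec)
    ultimately show "?Ae $ p = ((\<rho> + \<tau> \<cdot>\<^sub>v ?Bf) - (?Aie - \<tau> \<cdot>\<^sub>v ?Bif)) $ p"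
      using p dims \<rho>
      by (simp del: index_mult_mat_vec add: algebra_simps
          diff[OF window_mat_carrier c(1,2)] diff[OF window_mat_carrier c(3,4)]
          diff[OF window_mat0_carrier c0] diff[OF window_mat0_carrier cf])
  qed (simp add: window_mat_def window_mat0_def)
  then have "norm2 ?Ae \<le> norm2 (\<rho> + \<tau> \<cdot>\<^sub>v ?Bf) + norm2 (?Aie - \<tau> \<cdot>\<^sub>v ?Bif)"
    using norm2_minus[of "\<rho> + \<tau> \<cdot>\<^sub>v ?Bf" ?N "?Aie - \<tau> \<cdot>\<^sub>v ?Bif"] \<rho>
      cm[OF window_mat_carrier] cm[OF window_mat0_carrier] by simp
  also have "\<dots> \<le> (norm2 \<rho> + \<tau> * norm2 ?Bf) + (norm2 ?Aie + \<tau> * norm2 ?Bif)"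
    using norm2_add[of \<rho> ?N "\<tau> \<cdot>\<^sub>v ?Bf"] norm2_minus[of ?Aie ?N "\<tau> \<cdot>\<^sub>v ?Bif"] \<rho>
      cm[OF window_mat_carrier] cm[OF window_mat0_carrier] pos
    by (simp add: norm2_smult)
  also have "\<dots> \<le> (norm2 \<rho> + \<tau> * (sigma_max ?B * (\<kappa> * norm2 (v - y))))
      + (sigma_max ?Ai * norm2 (v0 - y0) + \<tau> * (sigma_max ?Bi * (\<kappa> * norm2 (v0 - y0))))"
  proof -
    have "norm2 ?Bf \<le> sigma_max ?B * norm2 (Fv - Fy)"
      using N c by (intro norm2_mult_le_sigma_max[OF window_mat_carrier]) auto
    also have "\<dots> \<le> sigma_max ?B * (\<kappa> * norm2 (v - y))"
      using window_rhs_lipschitz[OF M k _ A1 c(1,2)] \<open>0 < \<kappa>\<close> N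
        sigma_max_nonneg[OF window_mat_carrier]
      by (intro mult_left_mono) (auto simp: Fv_def Fy_def)
    finally have B: "norm2 ?Bf \<le> sigma_max ?B * (\<kappa> * norm2 (v - y))" .
    have "norm2 ?Bif \<le> sigma_max ?Bi * norm2 (f0v - f0y)"
      using N pos cf by (intro norm2_mult_le_sigma_max[OF window_mat0_carrier]) auto
    also have "\<dots> \<le> sigma_max ?Bi * (\<kappa> * norm2 (v0 - y0))"
      using A1 c0 time_in_horizon[OF M k, of 0] pos N sigma_max_nonneg[OF window_mat0_carrier]
      by (intro mult_left_mono) (auto simp: f0v_def f0y_def)
    finally have B0: "norm2 ?Bif \<le> sigma_max ?Bi * (\<kappa> * norm2 (v0 - y0))" .
    have A0: "norm2 ?Aie \<le> sigma_max ?Ai * norm2 (v0 - y0)"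
      using N pos c0 by (intro norm2_mult_le_sigma_max[OF window_mat0_carrier]) auto
    show ?thesis
      using A0 mult_left_mono[OF B, of \<tau>] mult_left_mono[OF B0, of \<tau>] pos by linarith
  qed
  finally have "sigma_min ?A * norm2 (v - y) \<le> \<dots>"
    using sigma_min_mult_norm2_le[OF window_mat_carrier N(1) order_refl, of "v - y" "alpha M"] c
    by (simp add: order_trans)
  \<comment> \<open>The term in \<open>norm2 (v - y)\<close> produced by \<open>?B\<close> moves to
    the left, which forms the constant that A2 makes positive.\<close>
  then have main: "norm2 (v - y) * (sigma_min ?A - sigma_max ?B * \<tau> * \<kappa>) \<le>
      norm2 \<rho> + (sigma_max ?Ai + \<tau> * \<kappa> * sigma_max ?Bi) * norm2 (v0 - y0)"
    by (simp add: algebra_simps)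
  have "norm2 (v - y) \<le> (norm2 \<rho> + (sigma_max ?Ai + \<tau> * \<kappa> * sigma_max ?Bi) * norm2 (v0 - y0))
      / (sigma_min ?A - sigma_max ?B * \<tau> * \<kappa>)"
    using A2 main by (simp add: pos_le_divide_eq \<tau>_def)
  then show ?thesis
    by (simp add: Let_def add_divide_distrib v_def y_def v0_def y0_def \<rho>_def \<tau>_def)
qed

end
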